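(* Let $\mathcal{G} = \mathcal{G}_1 + \dots + \mathcal{G}_R \in \mathbb{R}^{m\times\dots\times m}$ be a Waring decomposition of an order-$D$ tensor. (1) Let $Q\in\mathbb{R}^{n\times m}$ have orthonormal columns and set $\mathcal{A}_r = Q^{\otimes D}\mathcal{G}_r$ for $r=1,\dots,R$. Then $$\kappa_{\mathcal{W}_{Q,D}}(\mathcal{A}_1,\dots,\mathcal{A}_R)\le \kappa_{\mathcal{V}_{n,D}}(\mathcal{A}_1,\dots,\mathcal{A}_R)\le \sqrt{D}\cdot\kappa_{\mathcal{V}_{m,D}}(\mathcal{G}_1,\dots,\mathcal{G}_R)=\sqrt{D}\cdot\kappa_{\mathcal{W}_{Q,D}}(\mathcal{A}_1,\dots,\mathcal{A}_R).$$ (2) With $Q$ and $\mathcal{A}_r$ as in (1), let moreover $U\in\mathbb{R}^{\ell\times m}$ have orthonormal columns and set $\mathcal{B}_r := U^{\otimes D}\mathcal{G}_r$ for all $r=1,\dots,R$. If $\min(\ell,n)>m$, then $$\kappa_{\mathcal{V}_{n,D}}(\mathcal{A}_1,\dots,\mathcal{A}_R)=\kappa_{\mathcal{V}_{\ell,D}}(\mathcal{B}_1,\dots,\mathcal{B}_R).$$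
   Context: Tensors are real; $\|\cdot\|$ is the Euclidean (Frobenius) norm, and $\mathbb{S}^{n-1}=\{\mathbf{a}\in\mathbb{R}^n : \|\mathbf{a}\|_2=1\}$. For $\mathbf{a}\in\mathbb{R}^n$, $\mathbf{a}^{\otimes D}$ is the tensor product of $D$ copies of $\mathbf{a}$. For a matrix $Q\in\mathbb{R}^{n\times m}$, $Q^{\otimes D}$ denotes the linear map from order-$D$ tensors in $\mathbb{R}^{m\times\dots\times m}$ to order-$D$ tensors in $\mathbb{R}^{n\times\dots\times n}$ that applies $Q$ in every mode, so $Q^{\otimes D}(\mathbf{x}_1\otimes\dots\otimes\mathbf{x}_D)=(Q\mathbf{x}_1)\otimes\dots\otimes(Q\mathbf{x}_D)$. Decompositions. A canonical polyadic decomposition (CPD) of a tensor $\mathcal{A}\in\mathbb{R}^{n\times\dots\times n}$ of order $D$ is an expression $\mathcal{A}=\sum_{r=1}^R\mathcal{A}_r$ with $\mathcal{A}_r=\alpha_r\,\mathbf{a}_r^{(1)}\otimes\dots\otimes\mathbf{a}_r^{(D)}$, $\alpha_r\in\mathbb{R}\setminus\{0\}$, $\mathbf{a}_r^{(i)}\in\mathbb{S}^{n-1}$, where $R$ is minimal. A Waring decomposition is a CPD in which every summand is symmetric, i.e. $\mathcal{A}_r=\alpha_r\mathbf{a}_r^{\otimes D}$ with $\alpha_r\in\mathbb{R}\setminus\{0\}$ and $\mathbf{a}_r\in\mathbb{S}^{n-1}$. Manifolds. The Veronese manifold is $\mathcal{V}_{n,D}=\{\alpha\mathbf{x}^{\otimes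 D} : \alpha\in\mathbb{R}\setminus\{0\},\ \mathbf{x}\in\mathbb{S}^{n-1}\}\subset\mathbb{R}^{n\times\dots\times n}$ (order $D$). For $Q\in\mathbb{R}^{n\times m}$ with orthonormal columns, $\mathcal{W}_{Q,D}=Q^{\otimes D}(\mathcal{V}_{m,D})\subset\mathbb{R}^{n\times\dots\times n}$. Condition number. Let $\mathcal{M}$ be one of these manifolds, let $\mathfrak{a}=(\mathcal{A}_1,\dots,\mathcal{A}_R)\in\mathcal{M}^{\times R}$, let $\Sigma:\mathcal{M}^{\times R}\to\mathbb{R}^{n\times\dots\times n}$ be the addition map $(\mathcal{A}_1,\dots,\mathcal{A}_R)\mapsto\mathcal{A}_1+\dots+\mathcal{A}_R$, and put $\mathcal{A}=\Sigma(\mathfrak{a})$. If $\mathfrak{a}$ is an isolated decomposition of $\mathcal{A}$ and $\Sigma$ has a local inverse $\Sigma_{\mathfrak{a}}^{-1}$ at $\mathfrak{a}$, then $$\kappa_{\mathcal{M}}(\mathcal{A}_1,\dots,\mathcal{A}_R)=\lim_{\delta\to0}\ \sup_{\widetilde{\mathcal{A}}\in\Sigma(\mathcal{M}^{\times R}),\ \|\mathcal{A}-\widetilde{\mathcal{A}}\|\le\delta}\frac{\|\Sigma_{\mathfrak{a}}^{-1}(\mathcal{A})-\Sigma_{\mathfrak{a}}^{-1}(\widetilde{\mathcal{A}})\|}{\|\mathcal{A}-\widetilde{\mathcal{A}}\|},$$ and $\kappa_{\mathcal{M}}(\mathcal{A}_1,\dots,\mathcal{A}_R)=\infty$ if $\mathfrak{a}$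 is not isolated. By a known characterization, which may be taken as the working definition in all cases, $$\kappa_{\mathcal{M}}(\mathcal{A}_1,\dots,\mathcal{A}_R)=\sigma_{\min}\big([T_{\mathcal{A}_1}^{\mathcal{M}}\ \cdots\ T_{\mathcal{A}_R}^{\mathcal{M}}]\big)^{-1},$$ where the columns of $T_{\mathcal{A}_r}^{\mathcal{M}}$ form an orthonormal basis of the tangent space $T_{\mathcal{A}_r}\mathcal{M}$ (regarded as a linear subspace of the ambient tensor space), $\sigma_{\min}(T)=\min_{\|x\|=1}\|Tx\|$ is the smallest singular value, and $0^{-1}=\infty$. *)

theory Defs
  imports "HOL-Analysis.Analysis"
begin

text \<open>
  An order-\<open>D\<close> tensor in \<open>\<real>\<^bsup>n\<times>\<dots>\<times>n\<^esup>\<close> is a vector indexed by multi-indices \<open>'d \<Rightarrow> 'n\<close>, where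
  \<open>'d\<close> is the finite type of modes, \<open>D = CARD('d)\<close> and \<open>n = CARD('n)\<close>. The norm on this type
  is the Frobenius norm.
\<close>

type_synonym ('d, 'n) tensor = "(real, 'd \<Rightarrow> 'n) vec"

definition tprod :: "('d::finite \<Rightarrow> real ^ 'n) \<Rightarrow> ('d, 'n::finite) tensor" where
  "tprod a = (\<chi> i. \<Prod>k\<in>UNIV. a k $ i k)"

definition tensor_power :: "real ^ 'n \<Rightarrow> ('d::finite, 'n::finite) tensor" where
  "tensor_power a = tprod (\<lambda>_. a)"

text \<open>The map \<open>Q\<^sup>\<otimes>\<^sup>D\<close>; the lemmas \<open>linear_tensor_map\<close> and \<open>tensor_map_tprod\<close> below characterise it.\<close>

definition tensor_map ::
    "real ^ 'm ^ 'n \<Rightarrow> ('d::finite, 'm::finite) tensor \<Rightarrow> ('d, 'n::finite) tensor" where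
  "tensor_map Q T = (\<chi> i. \<Sum>j\<in>UNIV. (\<Prod>k\<in>UNIV. Q $ i k $ j k) * T $ j)"

lemma linear_tensor_map: "linear (tensor_map Q)"
  by (rule linearI)
     (simp_all add: tensor_map_def vec_eq_iff algebra_simps sum.distrib sum_distrib_left)

lemma tensor_map_tprod: "tensor_map Q (tprod x) = tprod (\<lambda>k. Q *v x k)"
proof -
  have "(\<Sum>j\<in>UNIV. (\<Prod>k\<in>UNIV. Q $ i k $ j k) * (\<Prod>k\<in>UNIV. x k $ j k))
      = (\<Prod>k\<in>UNIV. \<Sum>l\<in>UNIV. Q $ i k $ l * x k $ l)" for i
    using prod_sum_PiE[of UNIV "\<lambda>_. UNIV" "\<lambda>k l. Q $ i k $ l * x k $ l"]
    by (simp add: prod.distrib)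
  then show ?thesis
    by (simp add: tensor_map_def tprod_def matrix_vector_mult_def vec_eq_iff)
qed

definition orthonormal_columns :: "real ^ 'm ^ 'n \<Rightarrow> bool" where
  "orthonormal_columns Q \<longleftrightarrow>
     (\<forall>j. norm (column j Q) = 1) \<and>
     (\<forall>j k. j \<noteq> k \<longrightarrow> orthogonal (column j Q) (column k Q))"

definition rank_one :: "('d::finite, 'n::finite) tensor \<Rightarrow> bool" where
  "rank_one T \<longleftrightarrow> (\<exists>\<alpha> a. \<alpha> \<noteq> 0 \<and> (\<forall>k. a k \<in> sphere 0 1) \<and> T = \<alpha> *\<^sub>R tprod a)"

definition rank_one_sum ::
    "nat \<Rightarrow> (nat \<Rightarrow> ('d::finite, 'n::finite) tensor) \<Rightarrow> ('d, 'n) tensor \<Rightarrow> bool" where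
  "rank_one_sum R S T \<longleftrightarrow> (\<forall>r\<in>{1..R}. rank_one (S r)) \<and> T = (\<Sum>r=1..R. S r)"

definition cp_decomposition ::
    "nat \<Rightarrow> (nat \<Rightarrow> ('d::finite, 'n::finite) tensor) \<Rightarrow> ('d, 'n) tensor \<Rightarrow> bool" where
  "cp_decomposition R S T \<longleftrightarrow>
     rank_one_sum R S T \<and> (\<forall>R' S'. rank_one_sum R' S' T \<longrightarrow> R \<le> R')"

text \<open>Minimality of \<open>R\<close> is among all rank-one expressions, not only the symmetric ones.\<close>

definition waring_decomposition ::
    "nat \<Rightarrow> (nat \<Rightarrow> ('d::finite, 'n::finite) tensor) \<Rightarrow> ('d, 'n) tensor \<Rightarrow> bool" where
  "waring_decomposition R S T \<longleftrightarrow>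
     cp_decomposition R S T \<and>
     (\<forall>r\<in>{1..R}. \<exists>\<alpha> a. \<alpha> \<noteq> 0 \<and> a \<in> sphere 0 1 \<and> S r = \<alpha> *\<^sub>R tensor_power a)"

definition veronese :: "('d::finite, 'n::finite) tensor set" where
  "veronese = {\<alpha> *\<^sub>R tensor_power x | \<alpha> x. \<alpha> \<noteq> 0 \<and> x \<in> sphere 0 1}"

definition compressed_veronese :: "real ^ 'm ^ 'n \<Rightarrow> ('d::finite, 'n::finite) tensor set" where
  "compressed_veronese Q = tensor_map Q ` (veronese :: ('d, 'm::finite) tensor set)"

text \<open>The tangent space of an embedded submanifold \<open>M\<close> of the ambient space, as the set of
  velocities of curves in \<open>M\<close>.\<close>

definition tangent_space :: "'a::real_normed_vector set \<Rightarrow> 'a \<Rightarrow> 'a set" where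
  "tangent_space M p =
     {v. \<exists>\<gamma> \<epsilon>. \<epsilon> > 0 \<and> \<gamma> C1_differentiable_on {-\<epsilon><..<\<epsilon>} \<and> \<gamma> ` {-\<epsilon><..<\<epsilon>} \<subseteq> M \<and>
           \<gamma> 0 = p \<and> (\<gamma> has_vector_derivative v) (at 0)}"

definition orthonormal_basis_of :: "'a::euclidean_space set \<Rightarrow> 'a set \<Rightarrow> bool" where
  "orthonormal_basis_of S B \<longleftrightarrow>
     pairwise orthogonal B \<and> (\<forall>b\<in>B. norm b = 1) \<and> span B = S"

text \<open>Smallest singular value \<open>min\<^bsub>\<parallel>x\<parallel>=1\<^esub> \<parallel>T x\<parallel>\<close> of the matrix \<open>T\<close> whose columns are \<open>c i\<close>,
  \<open>i \<in> I\<close>. The infimum is attained, unless \<open>I\<close> is empty, in which case it is \<open>\<infinity>\<close>.\<close>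

definition sigma_min :: "'i set \<Rightarrow> ('i \<Rightarrow> 'a::euclidean_space) \<Rightarrow> ennreal" where
  "sigma_min I c = (INF x\<in>{x. L2_set x I = 1}. ennreal (norm (\<Sum>i\<in>I. x i *\<^sub>R c i)))"

text \<open>The columns of \<open>[T\<^sub>1 \<dots> T\<^sub>R]\<close> are indexed by pairs \<open>(r, b)\<close> with \<open>b\<close> in the chosen
  orthonormal basis of the tangent space at \<open>A r\<close>; the value does not depend on this choice.
  In \<open>ennreal\<close>, the inverse of \<open>0\<close> is \<open>\<infinity>\<close>.\<close>

definition condition_number ::
    "'a::euclidean_space set \<Rightarrow> nat \<Rightarrow> (nat \<Rightarrow> 'a) \<Rightarrow> ennreal" where
  "condition_number M R A =
     inverse (sigma_min
       (SIGMA r:{1..R}. SOME B. orthonormal_basis_of (tangent_space M (A r)) B) snd)"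

end

theory Submission imports Defs begin

text \<open>
  The tangent space of the Veronese manifold at \<open>\<alpha> a\<^sup>\<otimes>\<^sup>D\<close> consists of the sums
  \<open>\<tau>\<^sub>a(x) = \<Sum>\<^sub>k a \<otimes> \<dots> \<otimes> x \<otimes> \<dots> \<otimes> a\<close>, with \<open>x\<close> in mode \<open>k\<close>. Write \<open>x = Q y + z\<close> with \<open>z\<close> orthogonal
  to the range of \<open>Q\<close>. Then
  \<open>\<tau>\<^sub>Q\<^sub>a(x) \<bullet> \<tau>\<^sub>Q\<^sub>b(x') = \<tau>\<^sub>a(y) \<bullet> \<tau>\<^sub>b(y') + D (z \<bullet> z') (a \<bullet> b)\<^sup>D\<^sup>-\<^sup>1\<close>, so the matrix of tangent bases at the
  \<open>A\<^sub>r\<close> splits orthogonally into the one at the \<open>G\<^sub>r\<close> and a part that only involves the vectors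
  \<open>a\<^sub>r\<^sup>\<otimes>\<^sup>(\<^sup>D\<^sup>-\<^sup>1\<^sup>)\<close>. The second part occurs as soon as \<open>n > m\<close> and does not depend on \<open>Q\<close>, which gives (2); its
  smallest singular value is at least \<open>\<sigma>\<^sub>m\<^sub>i\<^sub>n / \<surd>D\<close> of the first part, which gives (1).
\<close>

subsection \<open>Condition numbers and tangent spaces\<close>

text \<open>Basis-free form of \<open>c \<le> \<sigma>\<^sub>m\<^sub>i\<^sub>n\<close>; squared, so that only inner products have to be computed.\<close>

definition lower_sum_bound :: "real \<Rightarrow> 'i set \<Rightarrow> ('i \<Rightarrow> 'a::real_normed_vector set) \<Rightarrow> bool" where
  "lower_sum_bound c I S \<longleftrightarrow>
     (\<forall>v. (\<forall>r\<in>I. v r \<in> S r) \<longrightarrow> c\<^sup>2 * (\<Sum>r\<in>I. (norm (v r))\<^sup>2) \<le> (norm (\<Sum>r\<in>I. v r))\<^sup>2)"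

lemma lower_sum_boundI:
  assumes "\<And>v. (\<And>r. r \<in> I \<Longrightarrow> v r \<in> S r) \<Longrightarrow>
    c\<^sup>2 * (\<Sum>r\<in>I. (norm (v r))\<^sup>2) \<le> (norm (\<Sum>r\<in>I. v r))\<^sup>2"
  shows "lower_sum_bound c I S"
  using assms unfolding lower_sum_bound_def by blast

lemma lower_sum_boundD:
  assumes "lower_sum_bound c I S" "\<And>r. r \<in> I \<Longrightarrow> v r \<in> S r"
  shows "c\<^sup>2 * (\<Sum>r\<in>I. (norm (v r))\<^sup>2) \<le> (norm (\<Sum>r\<in>I. v r))\<^sup>2"
  using assms unfolding lower_sum_bound_def by blast

lemma lower_sum_bound_subset:
  assumes "lower_sum_bound c I S" "\<And>r. r \<in> I \<Longrightarrow> S' r \<subseteq> S r"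
  shows "lower_sum_bound c I S'"
  using assms unfolding lower_sum_bound_def by (meson subsetD)

lemma lower_sum_bound_cong:
  assumes "\<And>r. r \<in> I \<Longrightarrow> S r = S' r"
  shows "lower_sum_bound c I S \<longleftrightarrow> lower_sum_bound c I S'"
  using assms by (simp add: lower_sum_bound_def)

lemma lower_sum_bound_mono:
  assumes "lower_sum_bound c I S" "0 \<le> c'" "c' \<le> c"
  shows "lower_sum_bound c' I S"
proof (rule lower_sum_boundI)
  fix v assume v: "\<And>r. r \<in> I \<Longrightarrow> v r \<in> S r"
  have "c'\<^sup>2 * (\<Sum>r\<in>I. (norm (v r))\<^sup>2) \<le> c\<^sup>2 * (\<Sum>r\<in>I. (norm (v r))\<^sup>2)"
    using assms(2,3) by (intro mult_right_mono power_mono sum_nonneg) auto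
  also have "\<dots> \<le> (norm (\<Sum>r\<in>I. v r))\<^sup>2"
    using v by (rule lower_sum_boundD[OF assms(1)])
  finally show "c'\<^sup>2 * (\<Sum>r\<in>I. (norm (v r))\<^sup>2) \<le> (norm (\<Sum>r\<in>I. v r))\<^sup>2" .
qed

text \<open>Only norms enter the inequality, and \<open>f\<close> preserves them on the summands as
  well as on their sum. This later identifies the bound at the embedded points of the compressed
  manifold with the one at the original points.\<close>

lemma lower_sum_bound_isometry:
  assumes f: "linear f" and iso: "\<And>x. norm (f x) = norm x"
    and S': "\<And>r. r \<in> I \<Longrightarrow> S' r = f ` S r"
  shows "lower_sum_bound c I S' \<longleftrightarrow> lower_sum_bound c I S"
proof
  assume L: "lower_sum_bound c I S'"
  show "lower_sum_bound c I S"
  proof (rule lower_sum_boundI)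
    fix v assume "\<And>r. r \<in> I \<Longrightarrow> v r \<in> S r"
    then have "c\<^sup>2 * (\<Sum>r\<in>I. (norm (f (v r)))\<^sup>2) \<le> (norm (\<Sum>r\<in>I. f (v r)))\<^sup>2"
      by (intro lower_sum_boundD[OF L]) (simp add: S')
    then show "c\<^sup>2 * (\<Sum>r\<in>I. (norm (v r))\<^sup>2) \<le> (norm (\<Sum>r\<in>I. v r))\<^sup>2"
      by (simp add: iso flip: linear_sum[OF f])
  qed
next
  assume L: "lower_sum_bound c I S"
  show "lower_sum_bound c I S'"
  proof (rule lower_sum_boundI)
    fix v assume "\<And>r. r \<in> I \<Longrightarrow> v r \<in> S' r"
    then have "\<forall>r\<in>I. \<exists>u. u \<in> S r \<and> v r = f u"
      using S' by blast
    then obtain u where "\<forall>r\<in>I. u r \<in> S r \<and> v r = f (u r)"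
      by (rule bchoice[THEN exE])
    then have u: "\<And>r. r \<in> I \<Longrightarrow> u r \<in> S r" "\<And>r. r \<in> I \<Longrightarrow> v r = f (u r)"
      by blast+
    have "c\<^sup>2 * (\<Sum>r\<in>I. (norm (u r))\<^sup>2) \<le> (norm (\<Sum>r\<in>I. u r))\<^sup>2"
      using u(1) by (rule lower_sum_boundD[OF L])
    then show "c\<^sup>2 * (\<Sum>r\<in>I. (norm (v r))\<^sup>2) \<le> (norm (\<Sum>r\<in>I. v r))\<^sup>2"
      by (simp add: iso u(2) flip: linear_sum[OF f])
  qed
qed

section \<open>Smallest singular values and condition numbers without bases\<close>

lemma orthonormal_basis_of_finite:
  assumes "orthonormal_basis_of S B"
  shows "finite B"
  using assms unfolding orthonormal_basis_of_def
  by (metis finiteI_independent norm_zero pairwise_orthogonal_independent zero_neq_one)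

lemma norm_sum_orthonormal:
  assumes "orthonormal_basis_of S B"
  shows "(norm (\<Sum>b\<in>B. x b *\<^sub>R b))\<^sup>2 = (\<Sum>b\<in>B. (x b)\<^sup>2)"
proof -
  have "(norm (\<Sum>b\<in>B. x b *\<^sub>R b))\<^sup>2 = (\<Sum>b\<in>B. (norm (x b *\<^sub>R b))\<^sup>2)"
    using assms
    by (intro norm_sum_Pythagorean orthonormal_basis_of_finite[OF assms])
       (auto simp: orthonormal_basis_of_def pairwise_def orthogonal_def)
  also have "\<dots> = (\<Sum>b\<in>B. (x b)\<^sup>2)"
    using assms by (intro sum.cong) (auto simp: orthonormal_basis_of_def)
  finally show ?thesis .
qed

text \<open>Coordinates in the orthonormal bases turn a vector \<open>x\<close> on the index set
  into a family \<open>v x r\<close> in \<open>S r\<close> whose squared norms add up to that of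
  \<open>x\<close>, and the matrix applied to \<open>x\<close> is the sum of this family.
  Homogeneity removes the restriction to unit vectors.\<close>

lemma le_sigma_min_iff:
  fixes S B :: "'i \<Rightarrow> 'a::euclidean_space set"
  assumes fin: "finite I" and B: "\<And>r. r \<in> I \<Longrightarrow> orthonormal_basis_of (S r) (B r)" and c: "c \<ge> 0"
  shows "ennreal c \<le> sigma_min (SIGMA r:I. B r) snd \<longleftrightarrow> lower_sum_bound c I S"
proof -
  define J where "J = (SIGMA r:I. B r)"
  define v where "v = (\<lambda>x r. \<Sum>b\<in>B r. x (r, b) *\<^sub>R b)"
  have finB: "finite (B r)" if "r \<in> I" for r
    using orthonormal_basis_of_finite[OF B[OF that]] .
  have sumv: "(\<Sum>i\<in>J. x i *\<^sub>R snd i) = (\<Sum>r\<in>I. v x r)" for x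
    unfolding J_def v_def by (subst sum.Sigma) (auto simp: fin finB split_def)
  have nv: "(\<Sum>r\<in>I. (norm (v x r))\<^sup>2) = (L2_set x J)\<^sup>2" for x
  proof -
    have "(\<Sum>r\<in>I. (norm (v x r))\<^sup>2) = (\<Sum>r\<in>I. \<Sum>b\<in>B r. (x (r, b))\<^sup>2)"
      unfolding v_def by (intro sum.cong refl norm_sum_orthonormal[OF B])
    also have "\<dots> = (\<Sum>i\<in>J. (x i)\<^sup>2)"
      unfolding J_def by (subst sum.Sigma) (auto simp: fin finB split_def)
    finally show ?thesis
      by (simp add: L2_set_def sum_nonneg)
  qed
  have "ennreal c \<le> sigma_min J snd \<longleftrightarrow> (\<forall>x. L2_set x J = 1 \<longrightarrow> c \<le> norm (\<Sum>r\<in>I. v x r))"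
    by (auto simp: sigma_min_def le_INF_iff sumv)
  also have "\<dots> \<longleftrightarrow> lower_sum_bound c I S"
  proof
    assume H: "\<forall>x. L2_set x J = 1 \<longrightarrow> c \<le> norm (\<Sum>r\<in>I. v x r)"
    show "lower_sum_bound c I S"
    proof (rule lower_sum_boundI)
      fix u assume u: "\<And>r. r \<in> I \<Longrightarrow> u r \<in> S r"
      define x where "x = (\<lambda>(r, b). u r \<bullet> b)"
      \<comment> \<open>The coordinate vector \<open>x\<close> of \<open>u\<close> need not have
        norm 1, so \<open>H\<close> is applied to \<open>x\<close> divided by \<open>N\<close> and
        scaled back; for \<open>N = 0\<close> the bound is trivial.\<close>
      define N where "N = L2_set x J"
      have vu: "v x r = u r" if "r \<in> I" for r
        unfolding v_def x_def using B[OF that] u[OF that] finB[OF that]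
        by (simp add: orthonormal_basis_of_def orthonormal_basis_expand)
      have "c * N \<le> norm (\<Sum>r\<in>I. v x r)"
      proof (cases "N = 0")
        case False
        then have N: "N > 0"
          using L2_set_nonneg[of x J] by (simp add: N_def less_le)
        have "L2_set (\<lambda>i. inverse N * x i) J = 1"
          using N L2_set_right_distrib[of "inverse N" x J] by (simp add: N_def)
        then have "c \<le> norm (\<Sum>r\<in>I. v (\<lambda>i. inverse N * x i) r)"
          using H by blast
        also have "(\<Sum>r\<in>I. v (\<lambda>i. inverse N * x i) r) = inverse N *\<^sub>R (\<Sum>r\<in>I. v x r)"
          by (simp add: v_def scaleR_sum_right)
        finally show ?thesis
          using N by (simp add: field_simps)
      qed simp
      then have "(c * N)\<^sup>2 \<le> (norm (\<Sum>r\<in>I. v x r))\<^sup>2"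
        by (rule power_mono) (simp add: N_def c L2_set_nonneg)
      moreover have "(\<Sum>r\<in>I. (norm (u r))\<^sup>2) = N\<^sup>2"
        unfolding N_def nv[symmetric] by (simp add: vu)
      moreover have "(\<Sum>r\<in>I. v x r) = (\<Sum>r\<in>I. u r)"
        by (simp add: vu)
      ultimately show "c\<^sup>2 * (\<Sum>r\<in>I. (norm (u r))\<^sup>2) \<le> (norm (\<Sum>r\<in>I. u r))\<^sup>2"
        by (simp add: power_mult_distrib)
    qed
  next
    assume L: "lower_sum_bound c I S"
    show "\<forall>x. L2_set x J = 1 \<longrightarrow> c \<le> norm (\<Sum>r\<in>I. v x r)"
    proof (intro allI impI)
      fix x assume x: "L2_set x J = 1"
      have "v x r \<in> S r" if "r \<in> I" for r
      proof -
        have "v x r \<in> span (B r)"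
          unfolding v_def by (intro span_sum span_scale span_base)
        then show ?thesis
          using B[OF that] by (simp add: orthonormal_basis_of_def)
      qed
      then have "c\<^sup>2 * (\<Sum>r\<in>I. (norm (v x r))\<^sup>2) \<le> (norm (\<Sum>r\<in>I. v x r))\<^sup>2"
        by (rule lower_sum_boundD[OF L])
      then have "c\<^sup>2 \<le> (norm (\<Sum>r\<in>I. v x r))\<^sup>2"
        by (simp add: nv x)
      then show "c \<le> norm (\<Sum>r\<in>I. v x r)"
        by (rule power2_le_imp_le) simp
    qed
  qed
  finally show ?thesis
    by (simp add: J_def)
qed

text \<open>Every subspace has an orthonormal basis, so the choice made by \<open>SOME\<close> is a
  genuine one, and the characterisation shows that its outcome does not matter.\<close>

lemma le_sigma_min_tangent_iff:
  fixes M :: "'a::euclidean_space set" and R :: nat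
  assumes "\<And>r. r \<in> {1..R} \<Longrightarrow> subspace (tangent_space M (A r))" "c \<ge> 0"
  shows "ennreal c \<le> sigma_min
      (SIGMA r:{1..R}. SOME B. orthonormal_basis_of (tangent_space M (A r)) B) snd
    \<longleftrightarrow> lower_sum_bound c {1..R} (\<lambda>r. tangent_space M (A r))"
proof (rule le_sigma_min_iff)
  fix r assume "r \<in> {1..R}"
  then have "\<exists>B. orthonormal_basis_of (tangent_space M (A r)) B"
    using orthonormal_basis_subspace[OF assms(1)] unfolding orthonormal_basis_of_def by metis
  then show "orthonormal_basis_of (tangent_space M (A r))
      (SOME B. orthonormal_basis_of (tangent_space M (A r)) B)"
    by (rule someI_ex)
qed (use assms(2) in auto)

lemma ennreal_inverse_antimono: "x \<le> y \<Longrightarrow> inverse y \<le> inverse (x :: ennreal)"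
  including ennreal.lifting by transfer (rule ereal_inverse_antimono)

text \<open>By \<open>lb\<close>, each lower bound for the first smallest singular value yields one
  for the second that is smaller by the factor \<open>k\<close>; inversion reverses the
  inequality.\<close>

lemma condition_number_le:
  fixes M :: "'a::euclidean_space set" and M' :: "'b::euclidean_space set"
  assumes sub: "\<And>r. r \<in> {1..R} \<Longrightarrow> subspace (tangent_space M (A r))"
    and sub': "\<And>r. r \<in> {1..R} \<Longrightarrow> subspace (tangent_space M' (A' r))"
    and k: "k > 0"
    and lb: "\<And>c. c \<ge> 0 \<Longrightarrow> lower_sum_bound c {1..R} (\<lambda>r. tangent_space M (A r)) \<Longrightarrow>
      lower_sum_bound (c / k) {1..R} (\<lambda>r. tangent_space M' (A' r))"
  shows "condition_number M' R A' \<le> ennreal k * condition_number M R A"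
proof -
  define s where
    "s = sigma_min (SIGMA r:{1..R}. SOME B. orthonormal_basis_of (tangent_space M (A r)) B) snd"
  define s' where
    "s' = sigma_min (SIGMA r:{1..R}. SOME B. orthonormal_basis_of (tangent_space M' (A' r)) B) snd"
  have s_le: "ennreal c \<le> s \<longleftrightarrow> lower_sum_bound c {1..R} (\<lambda>r. tangent_space M (A r))"
    if "c \<ge> 0" for c
    unfolding s_def by (rule le_sigma_min_tangent_iff[OF sub that])
  have s'_le: "ennreal c \<le> s' \<longleftrightarrow> lower_sum_bound c {1..R} (\<lambda>r. tangent_space M' (A' r))"
    if "c \<ge> 0" for c
    unfolding s'_def by (rule le_sigma_min_tangent_iff[OF sub' that])
  \<comment> \<open>Since \<open>s\<close> may be \<infinity>, it is approached from below by finite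
    values, which are the ones that \<open>lb\<close> can treat.\<close>
  have "s \<le> ennreal k * s'"
  proof (rule dense_le)
    fix x assume x: "x < s"
    then obtain c where c: "c \<ge> 0" "x = ennreal c"
      by (cases x) auto
    then have "ennreal (c / k) \<le> s'"
      using x k s_le[of c] s'_le[of "c / k"] lb[of c] by (simp add: less_imp_le del: One_nat_def)
    then have "ennreal k * ennreal (c / k) \<le> ennreal k * s'"
      by (rule mult_left_mono) simp
    then show "x \<le> ennreal k * s'"
      using k c by (simp flip: ennreal_mult)
  qed
  then have "inverse (ennreal k * s') \<le> inverse s"
    by (rule ennreal_inverse_antimono)
  then have "ennreal k * inverse (ennreal k * s') \<le> ennreal k * inverse s"
    by (rule mult_left_mono) simp
  moreover have "ennreal k * inverse (ennreal k * s') = inverse s'"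
  proof -
    have "inverse (ennreal k * s') = inverse (ennreal k) * inverse s'"
      using k by (cases "s' = top") (simp_all add: ennreal_inverse_mult ennreal_mult_top less_top)
    moreover have "ennreal k * (inverse (ennreal k) * inverse s') = inverse s'"
      using k by (simp add: inverse_ennreal flip: mult.assoc ennreal_mult)
    ultimately show ?thesis by simp
  qed
  ultimately show ?thesis
    by (simp add: condition_number_def s_def s'_def)
qed

lemma condition_number_eqI:
  fixes M :: "'a::euclidean_space set" and M' :: "'b::euclidean_space set"
  assumes "\<And>r. r \<in> {1..R} \<Longrightarrow> subspace (tangent_space M (A r))"
    and "\<And>r. r \<in> {1..R} \<Longrightarrow> subspace (tangent_space M' (A' r))"
    and "\<And>c. lower_sum_bound c {1..R} (\<lambda>r. tangent_space M (A r)) \<longleftrightarrow>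
      lower_sum_bound c {1..R} (\<lambda>r. tangent_space M' (A' r))"
  shows "condition_number M R A = condition_number M' R A'"
proof (rule antisym)
  show "condition_number M R A \<le> condition_number M' R A'"
    using condition_number_le[of R M' A' M A 1] assms by simp
  show "condition_number M' R A' \<le> condition_number M R A"
    using condition_number_le[of R M A M' A' 1] assms by simp
qed

section \<open>Tangent spaces under inclusions and linear maps\<close>

lemma tangent_space_subset: "M \<subseteq> N \<Longrightarrow> tangent_space M p \<subseteq> tangent_space N p"
  unfolding tangent_space_def by blast

lemma tangent_space_linear_image:
  fixes f :: "'a::euclidean_space \<Rightarrow> 'b::euclidean_space"
  assumes "linear f"
  shows "f ` tangent_space M p \<subseteq> tangent_space (f ` M) (f p)"
proof (intro image_subsetI)
  have f: "bounded_linear f"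
    using assms by (simp add: linear_conv_bounded_linear)
  fix v assume "v \<in> tangent_space M p"
  then obtain \<gamma> e where e: "e > 0" and C: "\<gamma> C1_differentiable_on {-e<..<e}"
    and im: "\<gamma> ` {-e<..<e} \<subseteq> M" and g0: "\<gamma> 0 = p" and d: "(\<gamma> has_vector_derivative v) (at 0)"
    unfolding tangent_space_def by blast
  from C obtain \<gamma>' where d': "\<And>t. t \<in> {-e<..<e} \<Longrightarrow> (\<gamma> has_vector_derivative \<gamma>' t) (at t)"
    and cont: "continuous_on {-e<..<e} \<gamma>'"
    unfolding C1_differentiable_on_def by blast
  have "f \<circ> \<gamma> C1_differentiable_on {-e<..<e}"
    unfolding C1_differentiable_on_def
  proof (intro exI conjI ballI)
    show "(f \<circ> \<gamma> has_vector_derivative f (\<gamma>' t)) (at t)" if "t \<in> {-e<..<e}" for t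
      unfolding o_def by (rule bounded_linear.has_vector_derivative[OF f d'[OF that]])
    show "continuous_on {-e<..<e} (\<lambda>t. f (\<gamma>' t))"
      by (rule bounded_linear.continuous_on[OF f cont])
  qed
  moreover have "(f \<circ> \<gamma> has_vector_derivative f v) (at 0)"
    unfolding o_def by (rule bounded_linear.has_vector_derivative[OF f d])
  moreover have "(f \<circ> \<gamma>) ` {-e<..<e} \<subseteq> f ` M"
    using im by (auto simp: image_subset_iff)
  ultimately show "f v \<in> tangent_space (f ` M) (f p)"
    using e g0 unfolding tangent_space_def by (auto intro!: exI[of _ "f \<circ> \<gamma>"] exI[of _ e])
qed

lemma tangent_space_isometric_image:
  fixes f :: "'a::euclidean_space \<Rightarrow> 'b::euclidean_space"
  assumes f: "linear f" and g: "linear g" and gf: "\<And>x. g (f x) = x"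
  shows "tangent_space (f ` M) (f p) = f ` tangent_space M p"
proof
  show "f ` tangent_space M p \<subseteq> tangent_space (f ` M) (f p)"
    by (rule tangent_space_linear_image[OF f])
  have fg: "bounded_linear (\<lambda>x. f (g x))"
    using linear_compose[OF g f] by (simp add: linear_conv_bounded_linear o_def)
  show "tangent_space (f ` M) (f p) \<subseteq> f ` tangent_space M p"
  proof
    fix v assume v: "v \<in> tangent_space (f ` M) (f p)"
    have "g v \<in> tangent_space (g ` f ` M) (g (f p))"
      using tangent_space_linear_image[OF g] v by blast
    then have "g v \<in> tangent_space M p"
      by (simp add: image_image gf)
    moreover have "f (g v) = v"
    proof -
      from v obtain \<gamma> e where e: "e > 0" and im: "\<gamma> ` {-e<..<e} \<subseteq> f ` M"
        and d: "(\<gamma> has_vector_derivative v) (at 0)"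
        unfolding tangent_space_def by blast
      have eq: "f (g (\<gamma> t)) = \<gamma> t" if "t \<in> {-e<..<e}" for t
      proof -
        have "\<gamma> t \<in> f ` M" using im that by blast
        then show ?thesis using gf by auto
      qed
      have "((\<lambda>t. f (g (\<gamma> t))) has_vector_derivative f (g v)) (at 0)"
        by (rule bounded_linear.has_vector_derivative[OF fg d])
      then have "(\<gamma> has_vector_derivative f (g v)) (at 0)"
        by (rule has_vector_derivative_transform_within_open[where S = "{-e<..<e}"])
           (use e eq in auto)
      then show ?thesis
        using d by (rule vector_derivative_unique_at)
    qed
    ultimately show "v \<in> f ` tangent_space M p"
      by (metis imageI)
  qed
qed

subsection \<open>The tangent space of the Veronese manifold\<close>

lemma inner_tprod: "tprod a \<bullet> tprod b = (\<Prod>k\<in>UNIV. a k \<bullet> b k)"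
  using prod_sum_PiE[of UNIV "\<lambda>_. UNIV" "\<lambda>k l. a k $ l * b k $ l"]
  by (simp add: inner_vec_def tprod_def prod.distrib)

lemma tprod_scale: "tprod (\<lambda>k. c k *\<^sub>R a k) = (\<Prod>k\<in>UNIV. c k) *\<^sub>R tprod a"
  by (simp add: tprod_def vec_eq_iff prod.distrib)

lemma tensor_power_scale:
  "tensor_power (c *\<^sub>R a) = c ^ CARD('d) *\<^sub>R (tensor_power a :: ('d::finite, 'n::finite) tensor)"
  by (simp add: tensor_power_def tprod_scale)

lemma tprod_fun_upd_nth:
  "tprod (a(k := x)) $ i = x $ i k * (\<Prod>j\<in>UNIV - {k}. a j $ i j)"
  by (simp add: tprod_def prod.remove[of UNIV k])

lemma linear_tprod_fun_upd: "linear (\<lambda>x. tprod (a(k := x)))"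
  by (rule linearI) (simp_all add: vec_eq_iff tprod_fun_upd_nth algebra_simps)

text \<open>The scalar \<alpha> of the base point is left out, since a nonzero factor does not
  change the range.\<close>

definition power_deriv :: "real ^ 'n \<Rightarrow> real ^ 'n \<Rightarrow> ('d::finite, 'n::finite) tensor" where
  "power_deriv a x = (\<Sum>k\<in>UNIV. tprod ((\<lambda>_. a)(k := x)))"

lemma linear_power_deriv: "linear (power_deriv a)"
  unfolding power_deriv_def by (intro linear_compose_sum ballI linear_tprod_fun_upd)

lemma subspace_range_power_deriv: "subspace (range (power_deriv a))"
  by (rule linear_subspace_image[OF linear_power_deriv subspace_UNIV])

text \<open>Euler's identity for a homogeneous map of degree D. It places the base point itself in
  the tangent space.\<close>

lemma power_deriv_self:
  "power_deriv a a = real CARD('d) *\<^sub>R (tensor_power a :: ('d::finite, 'n::finite) tensor)"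
  by (simp add: power_deriv_def tensor_power_def fun_upd_idem sum_constant_scaleR
      del: sum_constant)

text \<open>Among the pairs of modes, the D diagonal ones pair \<open>x\<close> with
  \<open>y\<close>; the D (D - 1) others pair \<open>x\<close> with \<open>b\<close> and
  \<open>a\<close> with \<open>y\<close>. For D = 1 the factor D - 1 vanishes, so the truncated
  exponent D - 2 does no harm.\<close>

lemma inner_power_deriv:
  "(power_deriv a x :: ('d::finite, 'n::finite) tensor) \<bullet> power_deriv b y =
     real CARD('d) * ((x \<bullet> y) * (a \<bullet> b) ^ (CARD('d) - 1)) +
     real CARD('d) * real (CARD('d) - 1) * ((x \<bullet> b) * (a \<bullet> y) * (a \<bullet> b) ^ (CARD('d) - 2))"
proof -
  let ?A = "\<lambda>k::'d. (\<lambda>_. a)(k := x)" and ?B = "\<lambda>k::'d. (\<lambda>_. b)(k := y)"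
  have diag: "tprod (?A k) \<bullet> tprod (?B k) = (x \<bullet> y) * (a \<bullet> b) ^ (CARD('d) - 1)" for k
    by (simp add: inner_tprod prod.remove[of UNIV k] card_Diff_singleton)
  have off: "tprod (?A k) \<bullet> tprod (?B l) = (x \<bullet> b) * (a \<bullet> y) * (a \<bullet> b) ^ (CARD('d) - 2)"
    if "l \<noteq> k" for k l
  proof -
    have "tprod (?A k) \<bullet> tprod (?B l) = (x \<bullet> b) * ((a \<bullet> y) * (\<Prod>j\<in>UNIV - {k} - {l}. ?A k j \<bullet> ?B l j))"
      using that by (simp add: inner_tprod prod.remove[of UNIV k] prod.remove[of "UNIV - {k}" l])
    also have "(\<Prod>j\<in>UNIV - {k} - {l}. ?A k j \<bullet> ?B l j) = (\<Prod>j\<in>UNIV - {k} - {l}. a \<bullet> b)"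
      by (intro prod.cong) auto
    also have "\<dots> = (a \<bullet> b) ^ (CARD('d) - 2)"
      using that by (simp add: card_Diff_singleton numeral_2_eq_2)
    finally show ?thesis by (simp only: mult.assoc)
  qed
  have "(power_deriv a x :: ('d, 'n) tensor) \<bullet> power_deriv b y
      = (\<Sum>k\<in>UNIV. \<Sum>l\<in>UNIV. tprod (?A k) \<bullet> tprod (?B l))"
    by (simp add: power_deriv_def inner_sum_left inner_sum_right)
      (rule sum.swap)
  also have "\<dots> = (\<Sum>k\<in>(UNIV :: 'd set). (x \<bullet> y) * (a \<bullet> b) ^ (CARD('d) - 1)
      + (\<Sum>l\<in>UNIV - {k}. (x \<bullet> b) * (a \<bullet> y) * (a \<bullet> b) ^ (CARD('d) - 2)))"
  proof (intro sum.cong refl)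
    fix k :: 'd
    show "(\<Sum>l\<in>UNIV. tprod (?A k) \<bullet> tprod (?B l)) = (x \<bullet> y) * (a \<bullet> b) ^ (CARD('d) - 1)
      + (\<Sum>l\<in>UNIV - {k}. (x \<bullet> b) * (a \<bullet> y) * (a \<bullet> b) ^ (CARD('d) - 2))"
      by (subst sum.remove[of UNIV k]) (auto simp: diag off)
  qed
  finally show ?thesis
    by (simp add: card_Diff_singleton distrib_left)
qed

text \<open>For \<open>b = a\<close> and \<open>y = x\<close> the off-diagonal term is D (D - 1)
  times the square of \<open>a \<bullet> x\<close>, hence nonnegative.\<close>

lemma norm_power_deriv_ge:
  assumes "norm a = 1"
  shows "real CARD('d) * (norm x)\<^sup>2 \<le> (norm (power_deriv a x :: ('d::finite, 'n::finite) tensor))\<^sup>2"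
proof -
  have "a \<bullet> a = 1"
    using assms by (simp add: norm_eq_1)
  then show ?thesis
    by (simp add: power2_norm_eq_inner inner_power_deriv inner_commute[of x a])
qed

text \<open>The factor \<open>norm x ^ CARD('d)\<close> is absorbed into \<alpha>. Without the
  normalisation, a straight line through \<open>a\<close> that avoids 0 gives a curve in the
  manifold.\<close>

lemma veronese_eq:
  "(veronese :: ('d::finite, 'n::finite) tensor set) = {\<alpha> *\<^sub>R tensor_power x | \<alpha> x. \<alpha> \<noteq> 0 \<and> x \<noteq> 0}"
proof (intro equalityI subsetI)
  fix T :: "('d, 'n) tensor"
  assume "T \<in> {\<alpha> *\<^sub>R tensor_power x | \<alpha> x. \<alpha> \<noteq> 0 \<and> x \<noteq> 0}"
  then obtain \<alpha> x where T: "T = \<alpha> *\<^sub>R tensor_power x" "\<alpha> \<noteq> 0" "x \<noteq> 0"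
    by blast
  have "T = (\<alpha> * norm x ^ CARD('d)) *\<^sub>R tensor_power (x /\<^sub>R norm x)"
    using T by (simp add: tensor_power_scale power_inverse)
  then show "T \<in> veronese"
    unfolding veronese_def using T
    by (intro CollectI exI[of _ "\<alpha> * norm x ^ CARD('d)"] exI[of _ "x /\<^sub>R norm x"]) auto
next
  fix T :: "('d, 'n) tensor"
  assume "T \<in> veronese"
  then obtain \<alpha> x where "T = \<alpha> *\<^sub>R tensor_power x" "\<alpha> \<noteq> 0" "norm x = 1"
    by (auto simp: veronese_def)
  moreover from this have "x \<noteq> 0"
    by auto
  ultimately show "T \<in> {\<alpha> *\<^sub>R tensor_power x | \<alpha> x. \<alpha> \<noteq> 0 \<and> x \<noteq> 0}"
    by blast
qed

lemma has_vector_derivative_tensor_power: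
  assumes "(w has_vector_derivative w') (at t)"
  shows "((\<lambda>t. tensor_power (w t) :: ('d::finite, 'n::finite) tensor)
    has_vector_derivative power_deriv (w t) w') (at t)"
proof -
  have w: "((\<lambda>t. w t $ l) has_real_derivative w' $ l) (at t)" for l
    using bounded_linear.has_vector_derivative[OF bounded_linear_vec_nth assms]
    by (simp add: has_real_derivative_iff_has_vector_derivative)
  have "((\<lambda>t. tensor_power (w t) $ i) has_vector_derivative power_deriv (w t) w' $ i) (at t)"
    for i :: "'d \<Rightarrow> 'n"
  proof -
    have "((\<lambda>t. \<Prod>k\<in>UNIV. w t $ i k) has_real_derivative
        (\<Sum>k\<in>UNIV. w' $ i k * (\<Prod>j\<in>UNIV - {k}. w t $ i j))) (at t)"
      by (rule has_field_derivative_prod) (rule w)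
    then show ?thesis
      by (simp add: has_real_derivative_iff_has_vector_derivative power_deriv_def tprod_fun_upd_nth)
         (simp add: tensor_power_def tprod_def)
  qed
  then show ?thesis
    unfolding has_vector_derivative_def
    by (subst has_derivative_componentwise_within) (auto simp: Basis_vec_def inner_axis)
qed

text \<open>A tensor \<open>T = \<beta> b\<^sup>\<otimes>\<^sup>D\<close> is recovered from its contractions against \<open>a\<close> as
  \<open>s\<^sup>D\<^sup>-\<^sup>1 T = w\<^sup>\<otimes>\<^sup>D\<close>, with \<open>s = \<beta> (b \<bullet> a)\<^sup>D\<close> the full contraction and \<open>w = \<beta> (b \<bullet> a)\<^sup>D\<^sup>-\<^sup>1 b\<close> the one
  that leaves a single mode free. Both are linear in \<open>T\<close>, so the identity can be differentiated
  along any curve, without choosing \<open>\<beta>\<close> and \<open>b\<close> differentiably.\<close>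

lemma tangent_space_veronese:
  fixes a :: "real ^ 'n::finite"
  assumes a: "norm a = 1" and \<alpha>: "\<alpha> \<noteq> 0"
  shows "tangent_space veronese (\<alpha> *\<^sub>R tensor_power a :: ('d::finite, 'n) tensor) = range (power_deriv a)"
proof (intro equalityI subsetI)
  fix v :: "('d, 'n) tensor"
  assume "v \<in> range (power_deriv a)"
  then obtain x where v: "v = power_deriv a x"
    by blast
  \<comment> \<open>Dividing by \<alpha> compensates the factor \<alpha> in the derivative of
    \<open>\<gamma>\<close>, so that the velocity at 0 is exactly \<open>v\<close>.\<close>
  define y where "y = x /\<^sub>R \<alpha>"
  define \<gamma> :: "real \<Rightarrow> ('d, 'n) tensor" where "\<gamma> = (\<lambda>t. \<alpha> *\<^sub>R tensor_power (a + t *\<^sub>R y))"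
  \<comment> \<open>For such \<open>t\<close> the vector \<open>t *\<^sub>R y\<close> is shorter
    than the unit vector \<open>a\<close>, so \<open>a + t *\<^sub>R y\<close> stays away from
    0.\<close>
  define e where "e = 1 / (norm y + 1)"
  have e: "e > 0"
    unfolding e_def by (simp add: add_nonneg_pos)
  have d: "(\<gamma> has_vector_derivative \<alpha> *\<^sub>R power_deriv (a + t *\<^sub>R y) y) (at t)" for t
    unfolding \<gamma>_def
    by (intro bounded_linear.has_vector_derivative[OF bounded_linear_scaleR_right]
        has_vector_derivative_tensor_power) (auto intro!: derivative_eq_intros)
  have "continuous_on {-e<..<e} (\<lambda>t. \<alpha> *\<^sub>R (power_deriv (a + t *\<^sub>R y) y :: ('d, 'n) tensor))"
    unfolding power_deriv_def
    by (subst continuous_on_componentwise)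
       (auto simp: Basis_vec_def inner_axis tprod_fun_upd_nth intro!: continuous_intros)
  then have "\<gamma> C1_differentiable_on {-e<..<e}"
    unfolding C1_differentiable_on_def using d by (intro exI conjI ballI)
  moreover have "\<gamma> t \<in> veronese" if t: "t \<in> {-e<..<e}" for t
  proof -
    have "\<bar>t\<bar> * norm y \<le> e * norm y"
      using t by (intro mult_right_mono) auto
    also have "\<dots> < 1"
      unfolding e_def by (simp add: divide_less_eq add_nonneg_pos)
    finally have "norm (t *\<^sub>R y) < norm a"
      using a by simp
    then have "a + t *\<^sub>R y \<noteq> 0"
      by (metis add_eq_0_iff norm_minus_cancel order_less_irrefl)
    then show ?thesis
      using \<alpha> unfolding veronese_eq \<gamma>_def by blast
  qed
  moreover have "(\<gamma> has_vector_derivative v) (at 0)"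
    using d[of 0] \<alpha> by (simp add: v y_def linear_scale[OF linear_power_deriv])
  moreover have "\<gamma> 0 = \<alpha> *\<^sub>R tensor_power a"
    by (simp add: \<gamma>_def)
  ultimately show "v \<in> tangent_space veronese (\<alpha> *\<^sub>R tensor_power a)"
    using e unfolding tangent_space_def by blast
next
  fix v :: "('d, 'n) tensor"
  assume "v \<in> tangent_space veronese (\<alpha> *\<^sub>R tensor_power a)"
  then obtain \<gamma> e where e: "e > 0" and im: "\<gamma> ` {-e<..<e} \<subseteq> veronese"
    and g0: "\<gamma> 0 = \<alpha> *\<^sub>R tensor_power a" and d: "(\<gamma> has_vector_derivative v) (at 0)"
    unfolding tangent_space_def by blast
  obtain D' where D: "CARD('d) = Suc D'"
    using zero_less_card_finite[where 'a = 'd] by (metis gr0_implies_Suc)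
  \<comment> \<open>The mode left free by \<open>w\<close> is arbitrary, because the tensors
    contracted are symmetric.\<close>
  define k0 :: 'd where "k0 = undefined"
  define s where "s = (\<lambda>T :: ('d, 'n) tensor. T \<bullet> tensor_power a)"
  define w where "w = (\<lambda>T :: ('d, 'n) tensor. \<chi> l. T \<bullet> tprod ((\<lambda>_. a)(k0 := axis l 1)))"
  have s: "bounded_linear s"
    unfolding s_def by (rule bounded_linear_inner_left)
  have "linear w"
    unfolding w_def by (rule linearI) (simp_all add: vec_eq_iff inner_add_left)
  then have w: "bounded_linear w"
    by (simp add: linear_conv_bounded_linear)
  have aa: "a \<bullet> a = 1"
    using a by (simp add: norm_eq_1)
  have s_eq: "s (\<beta> *\<^sub>R tensor_power b) = \<beta> * (b \<bullet> a) ^ Suc D'" for \<beta> b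
    by (simp add: s_def tensor_power_def inner_tprod D)
  have w_eq: "w (\<beta> *\<^sub>R tensor_power b) = (\<beta> * (b \<bullet> a) ^ D') *\<^sub>R b" for \<beta> b
    by (simp add: w_def tensor_power_def inner_tprod vec_eq_iff D inner_axis
        prod.remove[of UNIV k0] card_Diff_singleton)
  have key: "s T ^ D' *\<^sub>R T = tensor_power (w T)" if "T \<in> veronese" for T
  proof -
    from that obtain \<beta> b where T: "T = \<beta> *\<^sub>R tensor_power b"
      unfolding veronese_def by blast
    show ?thesis
      unfolding T s_eq w_eq by (simp add: tensor_power_scale D power_mult_distrib
          flip: power_mult power_Suc) (simp add: mult.commute)
  qed
  have ds: "((\<lambda>t. s (\<gamma> t)) has_vector_derivative s v) (at 0)"
    by (rule bounded_linear.has_vector_derivative[OF s d])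
  have dw: "((\<lambda>t. w (\<gamma> t)) has_vector_derivative w v) (at 0)"
    by (rule bounded_linear.has_vector_derivative[OF w d])
  have s0: "s (\<gamma> 0) = \<alpha>" and w0: "w (\<gamma> 0) = \<alpha> *\<^sub>R a"
    by (simp_all add: g0 s_eq w_eq aa)
  \<comment> \<open>Both sides of \<open>key\<close> are now differentiated along
    \<open>\<gamma>\<close> at 0. For \<open>D' = 0\<close> the factor \<open>real D'\<close> makes
    the truncated exponent \<open>D' - 1\<close> harmless.\<close>
  have "((\<lambda>t. s (\<gamma> t) ^ D') has_real_derivative (real D' * s v * \<alpha> ^ (D' - 1))) (at 0)"
    using ds by (auto simp flip: has_real_derivative_iff_has_vector_derivative
        intro!: derivative_eq_intros simp: s0)
  then have "((\<lambda>t. s (\<gamma> t) ^ D' *\<^sub>R \<gamma> t) has_vector_derivative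
      (s (\<gamma> 0) ^ D' *\<^sub>R v + (real D' * s v * \<alpha> ^ (D' - 1)) *\<^sub>R \<gamma> 0)) (at 0)"
    using d by (rule has_vector_derivative_scaleR)
  moreover have "((\<lambda>t. s (\<gamma> t) ^ D' *\<^sub>R \<gamma> t) has_vector_derivative power_deriv (w (\<gamma> 0)) (w v)) (at 0)"
    by (rule has_vector_derivative_transform_within_open
        [OF has_vector_derivative_tensor_power[OF dw], where S = "{-e<..<e}"])
       (use e im key in \<open>auto simp: image_subset_iff\<close>)
  ultimately have "s (\<gamma> 0) ^ D' *\<^sub>R v + (real D' * s v * \<alpha> ^ (D' - 1)) *\<^sub>R \<gamma> 0
      = power_deriv (w (\<gamma> 0)) (w v)"
    by (rule vector_derivative_unique_at)
  then have "\<alpha> ^ D' *\<^sub>R v = power_deriv (\<alpha> *\<^sub>R a) (w v) - (real D' * s v * \<alpha> ^ (D' - 1)) *\<^sub>R \<gamma> 0"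
    by (simp add: s0 w0 algebra_simps)
  moreover have "(power_deriv (\<alpha> *\<^sub>R a) (w v) :: ('d, 'n) tensor) = \<alpha> ^ D' *\<^sub>R power_deriv a (w v)"
    using D by (simp add: power_deriv_def vec_eq_iff tprod_fun_upd_nth prod.distrib
        card_Diff_singleton sum_distrib_left mult_ac)
  \<comment> \<open>The correction term from the product rule is a multiple of the base point and
    thus stays in the range, which leaves \<open>v\<close> there too.\<close>
  moreover have "\<gamma> 0 = power_deriv a ((\<alpha> / real CARD('d)) *\<^sub>R a)"
    by (simp add: g0 linear_scale[OF linear_power_deriv] power_deriv_self)
  ultimately have "\<alpha> ^ D' *\<^sub>R v \<in> range (power_deriv a)"
    by (simp add: subspace_range_power_deriv subspace_diff subspace_scale)
  then have "inverse (\<alpha> ^ D') *\<^sub>R \<alpha> ^ D' *\<^sub>R v \<in> range (power_deriv a)"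
    by (rule subspace_scale[OF subspace_range_power_deriv])
  then show "v \<in> range (power_deriv a)"
    using \<alpha> by (simp del: image_iff)
qed

section \<open>Tensor powers of a matrix with orthonormal columns\<close>

lemma inner_tensor_map:
  "tensor_map Q S \<bullet> T = S \<bullet> tensor_map (transpose Q) T"
proof -
  have "tensor_map Q S \<bullet> T
      = (\<Sum>i\<in>UNIV. \<Sum>j\<in>UNIV. (\<Prod>k\<in>UNIV. Q $ i k $ j k) * S $ j * T $ i)"
    by (simp add: inner_vec_def tensor_map_def sum_distrib_right)
  also have "\<dots> = S \<bullet> tensor_map (transpose Q) T"
    by (subst sum.swap)
       (simp add: inner_vec_def tensor_map_def sum_distrib_left transpose_def mult_ac)
  finally show ?thesis .
qed

text \<open>Exhibits the standard basis as elementary tensors, on which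
  \<open>tensor_map_tprod\<close> evaluates the induced map.\<close>

lemma axis_eq_tprod: "axis i 1 = tprod (\<lambda>k. axis (i k) 1)"
proof -
  have "(\<Prod>k\<in>UNIV. if j k = i k then 1 else 0 :: real) = (if j = i then 1 else 0)" for j
    by (auto simp: fun_eq_iff)
  then show ?thesis
    by (simp add: tprod_def axis_def vec_eq_iff)
qed

lemma transpose_orthonormal_columns:
  assumes "orthonormal_columns Q"
  shows "transpose Q ** Q = mat 1"
proof -
  have "column i Q \<bullet> column j Q = (if i = j then 1 else 0)" for i j
    using assms by (auto simp: orthonormal_columns_def orthogonal_def norm_eq_1)
  then show ?thesis
    by (simp add: vec_eq_iff matrix_matrix_mult_def transpose_def mat_def column_def inner_vec_def)
qed

text \<open>By linearity it suffices to test standard basis tensors. These are elementary, and in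
  each mode the claim becomes \<open>transpose Q ** Q = mat 1\<close>.\<close>

lemma tensor_map_transpose_cancel:
  fixes Q :: "real ^ 'm ^ 'n::finite"
  assumes "orthonormal_columns Q"
  shows "tensor_map (transpose Q) (tensor_map Q T) = (T :: ('d::finite, 'm::finite) tensor)"
proof -
  have "tensor_map (transpose Q) \<circ> tensor_map Q = (id :: ('d, 'm) tensor \<Rightarrow> _)"
  proof (rule linear_eq_stdbasis)
    fix b :: "('d, 'm) tensor" assume "b \<in> Basis"
    then obtain i where "b = tprod (\<lambda>k. axis (i k) 1)"
      by (auto simp: Basis_vec_def axis_eq_tprod)
    then show "(tensor_map (transpose Q) \<circ> tensor_map Q) b = id b"
      by (simp add: tensor_map_tprod matrix_vector_mul_assoc transpose_orthonormal_columns[OF assms])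
  qed (intro linear_compose linear_tensor_map linear_id)+
  then show ?thesis
    by (simp add: fun_eq_iff)
qed

lemma norm_tensor_map:
  assumes "orthonormal_columns Q"
  shows "norm (tensor_map Q T) = norm T"
  by (simp add: norm_eq_sqrt_inner inner_tensor_map tensor_map_transpose_cancel[OF assms])

lemma inner_matrix_vector_mult:
  fixes Q :: "real ^ 'm ^ 'n"
  shows "(Q *v x) \<bullet> y = x \<bullet> (transpose Q *v y)"
  using dot_lmul_matrix[of y Q x] by (simp add: inner_commute)

lemma inner_orthonormal_columns:
  assumes "orthonormal_columns Q"
  shows "(Q *v x) \<bullet> (Q *v y) = x \<bullet> y"
  by (simp add: inner_matrix_vector_mult matrix_vector_mul_assoc
      transpose_orthonormal_columns[OF assms] del: transpose_matrix_vector)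

subsection \<open>Splitting along the range of Q\<close>

lemma tensor_map_tensor_power:
  "tensor_map Q (\<alpha> *\<^sub>R tensor_power a) = \<alpha> *\<^sub>R tensor_power (Q *v a)"
  by (simp add: linear_scale[OF linear_tensor_map] tensor_power_def tensor_map_tprod)

lemma norm_orthonormal_columns:
  assumes "orthonormal_columns Q"
  shows "norm (Q *v x) = norm x"
  by (simp add: norm_eq_sqrt_inner inner_orthonormal_columns[OF assms])

lemma inner_transpose_kernel:
  fixes Q :: "real ^ 'm ^ 'n"
  assumes "transpose Q *v z = 0"
  shows "z \<bullet> (Q *v x) = 0"
  using assms by (simp add: inner_commute[of z] inner_matrix_vector_mult
      del: transpose_matrix_vector)

text \<open>Supplies a direction orthogonal to the range of \<open>Q\<close>, along which the second
  part of the splitting can be tested.\<close>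

lemma ex_unit_transpose_kernel:
  fixes Q :: "real ^ 'm::finite ^ 'n::finite"
  assumes "CARD('m) < CARD('n)"
  obtains e where "norm e = 1" "transpose Q *v e = 0"
proof -
  have "\<not> inj ((*v) (transpose Q))"
  proof
    assume "inj ((*v) (transpose Q))"
    then have "dim (range ((*v) (transpose Q))) = dim (UNIV :: (real ^ 'n) set)"
      by (intro dim_image_eq matrix_vector_mul_linear) (auto simp: inj_on_def)
    moreover have "dim (range ((*v) (transpose Q))) \<le> DIM(real ^ 'm)"
      by (rule dim_subset_UNIV)
    ultimately show False
      using assms by simp
  qed
  then obtain x where x: "transpose Q *v x = 0" "x \<noteq> 0"
    using linear_injective_0[OF matrix_vector_mul_linear] by blast
  then have "norm (x /\<^sub>R norm x) = 1" "transpose Q *v (x /\<^sub>R norm x) = 0"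
    by (auto simp: matrix_vector_mult_scaleR simp del: transpose_matrix_vector)
  then show thesis
    by (rule that)
qed

text \<open>The components \<open>z\<close> and \<open>z'\<close> are orthogonal to the range of
  \<open>Q\<close>. They contribute \<open>z \<bullet> z'\<close> to the diagonal term of
  \<open>inner_power_deriv\<close> and nothing to the off-diagonal one, where the vectors are paired
  with \<open>Q *v a\<close> and \<open>Q *v b\<close>.\<close>

lemma inner_power_deriv_split:
  assumes Q: "orthonormal_columns Q" and z: "transpose Q *v z = 0" and z': "transpose Q *v z' = 0"
  shows "(power_deriv (Q *v a) (Q *v y + z) :: ('d::finite, 'n::finite) tensor) \<bullet>
      power_deriv (Q *v b) (Q *v y' + z') =
    (power_deriv a y :: ('d, 'm::finite) tensor) \<bullet> power_deriv b y' +
      real CARD('d) * ((z \<bullet> z') * (a \<bullet> b) ^ (CARD('d) - 1))"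
proof -
  have "z \<bullet> (Q *v x) = 0" "(Q *v x) \<bullet> z' = 0" "(Q *v x) \<bullet> z = 0" "z' \<bullet> (Q *v x) = 0" for x
    using inner_transpose_kernel[OF z] inner_transpose_kernel[OF z'] by (simp_all add: inner_commute)
  then show ?thesis
    by (simp add: inner_power_deriv inner_add_left inner_add_right
        inner_orthonormal_columns[OF Q] algebra_simps)
qed

section \<open>Gram matrices of tensor powers of order D - 1\<close>

lemma power2_norm_sum:
  fixes f :: "'i \<Rightarrow> 'a::real_inner"
  shows "(norm (\<Sum>r\<in>I. f r))\<^sup>2 = (\<Sum>r\<in>I. \<Sum>s\<in>I. f r \<bullet> f s)"
  by (simp add: power2_norm_eq_inner inner_sum_left inner_sum_right)
     (rule sum.swap)

text \<open>For \<open>c \<ge> 0\<close> this says that \<open>c\<close> is at most the smallest singular value of the matrix with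
  columns \<open>a\<^sub>r\<^sup>\<otimes>\<^sup>p\<close>. The Gram matrix avoids tensors of order \<open>p = D - 1\<close>, which may be \<open>0\<close>.\<close>

definition gram_bound :: "nat \<Rightarrow> real \<Rightarrow> 'i set \<Rightarrow> ('i \<Rightarrow> 'a::real_inner) \<Rightarrow> bool" where
  "gram_bound p c I a \<longleftrightarrow>
     (\<forall>w. c\<^sup>2 * (\<Sum>r\<in>I. (w r)\<^sup>2) \<le> (\<Sum>r\<in>I. \<Sum>s\<in>I. w r * w s * (a r \<bullet> a s) ^ p))"

text \<open>The scalar inequality is applied to each coordinate of the weights \<open>z r\<close>,
  and the results are added up.\<close>

lemma gram_bound_vec:
  fixes z :: "'i \<Rightarrow> real ^ 'n::finite"
  assumes "gram_bound p c I a"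
  shows "c\<^sup>2 * (\<Sum>r\<in>I. (norm (z r))\<^sup>2) \<le> (\<Sum>r\<in>I. \<Sum>s\<in>I. (z r \<bullet> z s) * (a r \<bullet> a s) ^ p)"
proof -
  have "c\<^sup>2 * (\<Sum>r\<in>I. (norm (z r))\<^sup>2) = c\<^sup>2 * (\<Sum>r\<in>I. \<Sum>j\<in>UNIV. (z r $ j)\<^sup>2)"
    by (simp add: power2_norm_eq_inner inner_vec_def flip: power2_eq_square)
  also have "\<dots> = (\<Sum>j\<in>UNIV. c\<^sup>2 * (\<Sum>r\<in>I. (z r $ j)\<^sup>2))"
    by (subst sum.swap) (simp add: sum_distrib_left)
  also have "\<dots> \<le> (\<Sum>j\<in>UNIV. \<Sum>r\<in>I. \<Sum>s\<in>I. z r $ j * z s $ j * (a r \<bullet> a s) ^ p)"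
    by (intro sum_mono assms[unfolded gram_bound_def, rule_format])
  also have "\<dots> = (\<Sum>r\<in>I. \<Sum>s\<in>I. (z r \<bullet> z s) * (a r \<bullet> a s) ^ p)"
    by (subst sum.swap, rule sum.cong[OF refl], subst sum.swap)
       (simp add: inner_vec_def sum_distrib_right)
  finally show ?thesis .
qed

text \<open>Inserting a fixed unit vector \<open>y\<close> in every mode turns \<open>\<Sum>\<^sub>r w\<^sub>r a\<^sub>r\<^sup>\<otimes>\<^sup>p\<close> into a sum of tangent vectors:
  its norm grows by a factor of at most \<open>D\<close>, those of the summands by at least \<open>\<surd>D\<close>.\<close>

lemma gram_bound_of_lower_sum_bound:
  fixes a :: "'i \<Rightarrow> real ^ 'n::finite"
  assumes L: "lower_sum_bound c I (\<lambda>r. range (power_deriv (a r) :: _ \<Rightarrow> ('d::finite, 'n) tensor))"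
    and a: "\<And>r. r \<in> I \<Longrightarrow> norm (a r) = 1"
  shows "gram_bound (CARD('d) - 1) (c / sqrt (real CARD('d))) I a"
  unfolding gram_bound_def
proof
  fix w :: "'i \<Rightarrow> real"
  define g where "g = (\<Sum>r\<in>I. \<Sum>s\<in>I. w r * w s * (a r \<bullet> a s) ^ (CARD('d) - 1))"
  define y :: "real ^ 'n" where "y = axis undefined 1"
  have y: "y \<bullet> y = 1"
    by (simp add: y_def inner_axis_axis)
  \<comment> \<open>\<open>V k\<close> collects the terms with \<open>y\<close> in mode
    \<open>k\<close>. As \<open>y \<bullet> y = 1\<close>, its squared norm is the Gram form
    \<open>g\<close>, whatever \<open>k\<close> is.\<close>
  define V where "V = (\<lambda>k. \<Sum>r\<in>I. w r *\<^sub>R (tprod ((\<lambda>_. a r)(k := y)) :: ('d, 'n) tensor))"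
  have nV: "(norm (V k))\<^sup>2 = g" for k
    unfolding V_def power2_norm_sum g_def
    by (simp add: inner_tprod prod.remove[of UNIV k] card_Diff_singleton y mult_ac)
  have "g \<ge> 0"
    using nV[of undefined] by (metis zero_le_power2)
  have "(\<Sum>r\<in>I. w r *\<^sub>R power_deriv (a r) y) = (\<Sum>k\<in>UNIV. V k)"
    by (simp add: power_deriv_def V_def scaleR_sum_right) (rule sum.swap)
  also have "norm \<dots> \<le> (\<Sum>k\<in>(UNIV :: 'd set). sqrt g)"
    by (intro sum_norm_le) (simp add: real_le_rsqrt nV)
  finally have "norm (\<Sum>r\<in>I. w r *\<^sub>R (power_deriv (a r) y :: ('d, 'n) tensor)) \<le> real CARD('d) * sqrt g"
    by simp
  then have "(norm (\<Sum>r\<in>I. w r *\<^sub>R (power_deriv (a r) y :: ('d, 'n) tensor)))\<^sup>2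
      \<le> (real CARD('d) * sqrt g)\<^sup>2"
    by (rule power_mono) simp
  also have "\<dots> = (real CARD('d))\<^sup>2 * g"
    using \<open>g \<ge> 0\<close> by (simp add: power_mult_distrib)
  finally have upper: "(norm (\<Sum>r\<in>I. w r *\<^sub>R (power_deriv (a r) y :: ('d, 'n) tensor)))\<^sup>2
      \<le> (real CARD('d))\<^sup>2 * g" .
  have "real CARD('d) * (c\<^sup>2 * (\<Sum>r\<in>I. (w r)\<^sup>2)) = c\<^sup>2 * (\<Sum>r\<in>I. (w r)\<^sup>2 * (real CARD('d) * (norm y)\<^sup>2))"
    by (simp add: power2_norm_eq_inner y mult_ac flip: sum_distrib_left sum_distrib_right)
  also have "\<dots> \<le> c\<^sup>2 * (\<Sum>r\<in>I. (w r)\<^sup>2 * (norm (power_deriv (a r) y :: ('d, 'n) tensor))\<^sup>2)"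
    by (intro mult_left_mono sum_mono norm_power_deriv_ge a) auto
  also have "\<dots> = c\<^sup>2 * (\<Sum>r\<in>I. (norm (w r *\<^sub>R (power_deriv (a r) y :: ('d, 'n) tensor)))\<^sup>2)"
    by (simp add: power_mult_distrib)
  also have "\<dots> \<le> (norm (\<Sum>r\<in>I. w r *\<^sub>R (power_deriv (a r) y :: ('d, 'n) tensor)))\<^sup>2"
    by (rule lower_sum_boundD[OF L]) (simp add: subspace_scale[OF subspace_range_power_deriv])
  also note upper
  \<comment> \<open>The bounds combine with a factor D on the left and its square on the right. One
    factor cancels, and the other becomes the square root of D dividing \<open>c\<close>.\<close>
  finally have "c\<^sup>2 * (\<Sum>r\<in>I. (w r)\<^sup>2) \<le> real CARD('d) * g"
    by (simp add: power2_eq_square)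
  then show "(c / sqrt (real CARD('d)))\<^sup>2 * (\<Sum>r\<in>I. (w r)\<^sup>2)
      \<le> (\<Sum>r\<in>I. \<Sum>s\<in>I. w r * w s * (a r \<bullet> a s) ^ (CARD('d) - 1))"
    by (simp add: g_def power_divide field_simps)
qed

section \<open>Lower bounds before and after the embedding\<close>

text \<open>Both sides of the inequality split into a part from the tangent vectors
  \<open>u r\<close> and D times a part from the \<open>z r\<close>. These are controlled by
  \<open>L\<close> and \<open>G\<close> respectively; the norms \<open>norm (a r) = 1\<close> make
  the Gram factor on the diagonal equal to 1.\<close>

lemma lower_sum_bound_embedI:
  fixes a :: "'i \<Rightarrow> real ^ 'm::finite" and Q :: "real ^ 'm ^ 'n::finite"
  assumes Q: "orthonormal_columns Q"
    and L: "lower_sum_bound c I (\<lambda>r. range (power_deriv (a r) :: _ \<Rightarrow> ('d::finite, 'm) tensor))"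
    and G: "gram_bound (CARD('d) - 1) c I a"
    and a: "\<And>r. r \<in> I \<Longrightarrow> norm (a r) = 1"
  shows "lower_sum_bound c I (\<lambda>r. range (power_deriv (Q *v a r) :: _ \<Rightarrow> ('d, 'n) tensor))"
proof (rule lower_sum_boundI)
  fix v :: "'i \<Rightarrow> ('d, 'n) tensor"
  assume "\<And>r. r \<in> I \<Longrightarrow> v r \<in> range (power_deriv (Q *v a r))"
  then have "\<forall>r\<in>I. \<exists>x. v r = power_deriv (Q *v a r) x"
    by blast
  then obtain x where x: "\<And>r. r \<in> I \<Longrightarrow> v r = power_deriv (Q *v a r) (x r)"
    by metis
  \<comment> \<open>Since \<open>transpose Q ** Q = mat 1\<close>, the vector
    \<open>Q *v y r\<close> is the orthogonal projection of \<open>x r\<close> onto the range of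
    \<open>Q\<close>, and \<open>z r\<close> is the remainder.\<close>
  define y where "y = (\<lambda>r. transpose Q *v x r)"
  define z where "z = (\<lambda>r. x r - Q *v y r)"
  define u where "u = (\<lambda>r. power_deriv (a r) (y r) :: ('d, 'm) tensor)"
  have z: "transpose Q *v z r = 0" for r
    unfolding z_def y_def
    by (simp add: matrix_vector_mult_diff_distrib matrix_vector_mul_assoc matrix_mul_assoc
        transpose_orthonormal_columns[OF Q] del: transpose_matrix_vector)
  have v: "v r = power_deriv (Q *v a r) (Q *v y r + z r)" if "r \<in> I" for r
    using x[OF that] by (simp add: z_def)
  have split: "v r \<bullet> v s = u r \<bullet> u s + real CARD('d) * ((z r \<bullet> z s) * (a r \<bullet> a s) ^ (CARD('d) - 1))"
    if "r \<in> I" "s \<in> I" for r s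
    unfolding v[OF that(1)] v[OF that(2)] u_def by (rule inner_power_deriv_split[OF Q z z])
  have "c\<^sup>2 * (\<Sum>r\<in>I. (norm (v r))\<^sup>2) =
      c\<^sup>2 * (\<Sum>r\<in>I. (norm (u r))\<^sup>2) + real CARD('d) * (c\<^sup>2 * (\<Sum>r\<in>I. (norm (z r))\<^sup>2))"
    by (simp add: power2_norm_eq_inner split a[unfolded norm_eq_1] sum.distrib sum_distrib_left
        algebra_simps)
  also have "\<dots> \<le> (norm (\<Sum>r\<in>I. u r))\<^sup>2
      + real CARD('d) * (\<Sum>r\<in>I. \<Sum>s\<in>I. (z r \<bullet> z s) * (a r \<bullet> a s) ^ (CARD('d) - 1))"
    by (intro add_mono mult_left_mono lower_sum_boundD[OF L] gram_bound_vec[OF G])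
       (auto simp: u_def)
  also have "\<dots> = (norm (\<Sum>r\<in>I. v r))\<^sup>2"
    by (simp add: power2_norm_sum split sum.distrib sum_distrib_left)
  finally show "c\<^sup>2 * (\<Sum>r\<in>I. (norm (v r))\<^sup>2) \<le> (norm (\<Sum>r\<in>I. v r))\<^sup>2" .
qed

text \<open>The bound is tested on special tangent vectors: directions \<open>Q *v y r\<close>
  recover the bound before the embedding, and multiples \<open>w r *\<^sub>R e\<close> of one unit
  vector orthogonal to the range give the Gram bound.\<close>

lemma lower_sum_bound_embedD:
  fixes a :: "'i \<Rightarrow> real ^ 'm::finite" and Q :: "real ^ 'm ^ 'n::finite"
  assumes Q: "orthonormal_columns Q"
    and L: "lower_sum_bound c I (\<lambda>r. range (power_deriv (Q *v a r) :: _ \<Rightarrow> ('d::finite, 'n) tensor))"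
    and a: "\<And>r. r \<in> I \<Longrightarrow> norm (a r) = 1"
  shows "lower_sum_bound c I (\<lambda>r. range (power_deriv (a r) :: _ \<Rightarrow> ('d, 'm) tensor))"
    and "CARD('m) < CARD('n) \<Longrightarrow> gram_bound (CARD('d) - 1) c I a"
proof -
  show "lower_sum_bound c I (\<lambda>r. range (power_deriv (a r) :: _ \<Rightarrow> ('d, 'm) tensor))"
  proof (rule lower_sum_boundI)
    fix u :: "'i \<Rightarrow> ('d, 'm) tensor"
    assume "\<And>r. r \<in> I \<Longrightarrow> u r \<in> range (power_deriv (a r))"
    then have "\<forall>r\<in>I. \<exists>y. u r = power_deriv (a r) y"
      by blast
    then obtain y where y: "\<And>r. r \<in> I \<Longrightarrow> u r = power_deriv (a r) (y r)"
      by metis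
    define v where "v = (\<lambda>r. power_deriv (Q *v a r) (Q *v y r) :: ('d, 'n) tensor)"
    have "v r \<bullet> v s = u r \<bullet> u s" if "r \<in> I" "s \<in> I" for r s
      using inner_power_deriv_split[OF Q, of 0 0 "a r" "y r" "a s" "y s", where 'd = 'd]
      by (simp add: v_def y that)
    moreover have "c\<^sup>2 * (\<Sum>r\<in>I. (norm (v r))\<^sup>2) \<le> (norm (\<Sum>r\<in>I. v r))\<^sup>2"
      by (rule lower_sum_boundD[OF L]) (simp add: v_def)
    ultimately show "c\<^sup>2 * (\<Sum>r\<in>I. (norm (u r))\<^sup>2) \<le> (norm (\<Sum>r\<in>I. u r))\<^sup>2"
      by (simp add: power2_norm_sum power2_norm_eq_inner[of "v _"] power2_norm_eq_inner[of "u _"])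
  qed
next
  assume "CARD('m) < CARD('n)"
  then obtain e where e: "norm e = 1" "transpose Q *v e = 0"
    by (rule ex_unit_transpose_kernel)
  show "gram_bound (CARD('d) - 1) c I a"
    unfolding gram_bound_def
  proof
    fix w :: "'i \<Rightarrow> real"
    define v where "v = (\<lambda>r. power_deriv (Q *v a r) (w r *\<^sub>R e) :: ('d, 'n) tensor)"
    have v: "v r \<bullet> v s = real CARD('d) * (w r * w s * (a r \<bullet> a s) ^ (CARD('d) - 1))" for r s
      using inner_power_deriv_split[OF Q, of "w r *\<^sub>R e" "w s *\<^sub>R e" "a r" 0 "a s" 0, where 'd = 'd] e
      by (simp add: v_def matrix_vector_mult_scaleR linear_0[OF linear_power_deriv] norm_eq_1)
    have "c\<^sup>2 * (\<Sum>r\<in>I. (norm (v r))\<^sup>2) \<le> (norm (\<Sum>r\<in>I. v r))\<^sup>2"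
      by (rule lower_sum_boundD[OF L]) (simp add: v_def)
    moreover have "(norm (v r))\<^sup>2 = real CARD('d) * (w r)\<^sup>2" if "r \<in> I" for r
      unfolding power2_norm_eq_inner v using a[OF that] by (simp add: norm_eq_1 power2_eq_square)
    moreover have "(norm (\<Sum>r\<in>I. v r))\<^sup>2
        = real CARD('d) * (\<Sum>r\<in>I. \<Sum>s\<in>I. w r * w s * (a r \<bullet> a s) ^ (CARD('d) - 1))"
      by (simp add: power2_norm_sum v sum_distrib_left)
    ultimately have "real CARD('d) * (c\<^sup>2 * (\<Sum>r\<in>I. (w r)\<^sup>2)) \<le>
        real CARD('d) * (\<Sum>r\<in>I. \<Sum>s\<in>I. w r * w s * (a r \<bullet> a s) ^ (CARD('d) - 1))"
      by (simp add: sum_distrib_left mult_ac)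
    then show "c\<^sup>2 * (\<Sum>r\<in>I. (w r)\<^sup>2) \<le> (\<Sum>r\<in>I. \<Sum>s\<in>I. w r * w s * (a r \<bullet> a s) ^ (CARD('d) - 1))"
      by simp
  qed
qed

section \<open>Tangent spaces at the embedded points and the resulting comparison\<close>

lemma compressed_veronese_subset:
  assumes "orthonormal_columns Q"
  shows "compressed_veronese Q \<subseteq> veronese"
proof
  fix T assume "T \<in> compressed_veronese Q"
  then obtain \<alpha> x where "T = \<alpha> *\<^sub>R tensor_power (Q *v x)" "\<alpha> \<noteq> 0" "norm x = 1"
    by (auto simp: compressed_veronese_def veronese_def tensor_map_tensor_power)
  then show "T \<in> veronese"
    using norm_orthonormal_columns[OF assms, of x] unfolding veronese_def by auto
qed

lemma tangent_space_veronese_tensor_map: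
  fixes Q :: "real ^ 'm::finite ^ 'n::finite"
  assumes "orthonormal_columns Q" "norm a = 1" "\<alpha> \<noteq> 0"
  shows "tangent_space veronese (tensor_map Q (\<alpha> *\<^sub>R tensor_power a) :: ('d::finite, 'n) tensor)
    = range (power_deriv (Q *v a))"
  using assms
  by (simp add: tensor_map_tensor_power tangent_space_veronese norm_orthonormal_columns)

lemma tangent_space_compressed_veronese:
  assumes "orthonormal_columns Q"
  shows "tangent_space (compressed_veronese Q) (tensor_map Q T)
    = tensor_map Q ` tangent_space veronese T"
  unfolding compressed_veronese_def
  by (rule tangent_space_isometric_image[OF linear_tensor_map linear_tensor_map
      tensor_map_transpose_cancel[OF assms]])

text \<open>The right-hand side involves neither \<open>Q\<close> nor the dimension of its target,
  so two embeddings can be compared through it.\<close>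

lemma lower_sum_bound_embed_iff:
  fixes a :: "'i \<Rightarrow> real ^ 'm::finite" and Q :: "real ^ 'm ^ 'n::finite"
  assumes "orthonormal_columns Q" "CARD('m) < CARD('n)" "\<And>r. r \<in> I \<Longrightarrow> norm (a r) = 1"
  shows "lower_sum_bound c I (\<lambda>r. range (power_deriv (Q *v a r) :: _ \<Rightarrow> ('d::finite, 'n) tensor))
    \<longleftrightarrow> lower_sum_bound c I (\<lambda>r. range (power_deriv (a r) :: _ \<Rightarrow> ('d, 'm) tensor)) \<and>
      gram_bound (CARD('d) - 1) c I a"
  (is "?L \<longleftrightarrow> ?R")
proof
  show "?L \<Longrightarrow> ?R"
    by (intro conjI lower_sum_bound_embedD[OF assms(1)] assms(2,3))
  show "?R \<Longrightarrow> ?L"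
    by (elim conjE, rule lower_sum_bound_embedI[OF assms(1)]) (use assms(3) in auto)
qed

theorem theorem1p1:
  fixes G :: "('d::finite, 'm::finite) tensor"
    and Gs :: "nat \<Rightarrow> ('d, 'm) tensor"
    and R :: nat
  assumes "waring_decomposition R Gs G"
  shows
    "(\<forall>(Q :: real ^ 'm ^ 'n::finite) (As :: nat \<Rightarrow> ('d, 'n) tensor).
        orthonormal_columns Q \<and> (\<forall>r\<in>{1..R}. As r = tensor_map Q (Gs r)) \<longrightarrow>
          condition_number (compressed_veronese Q) R As \<le> condition_number veronese R As \<and>
          condition_number veronese R As
            \<le> ennreal (sqrt (real CARD('d))) * condition_number veronese R Gs \<and>
          ennreal (sqrt (real CARD('d))) * condition_number veronese R Gs
            = ennreal (sqrt (real CARD('d))) * condition_number (compressed_veronese Q) R As) \<and>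
     (\<forall>(Q :: real ^ 'm ^ 'n::finite) (As :: nat \<Rightarrow> ('d, 'n) tensor)
       (U :: real ^ 'm ^ 'l::finite) (Bs :: nat \<Rightarrow> ('d, 'l) tensor).
        orthonormal_columns Q \<and> (\<forall>r\<in>{1..R}. As r = tensor_map Q (Gs r)) \<and>
        orthonormal_columns U \<and> (\<forall>r\<in>{1..R}. Bs r = tensor_map U (Gs r)) \<and>
        min CARD('l) CARD('n) > CARD('m) \<longrightarrow>
          condition_number veronese R As = condition_number veronese R Bs)"
proof -
  \<comment> \<open>Only the unit vectors are fixed; the scalars stay existential, because the
    tangent spaces depend on the \<open>a r\<close> alone.\<close>
  have "\<forall>r\<in>{1..R}. \<exists>a. norm a = 1 \<and> (\<exists>\<alpha>. \<alpha> \<noteq> 0 \<and> Gs r = \<alpha> *\<^sub>R tensor_power a)"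
    using assms unfolding waring_decomposition_def by (fastforce simp: sphere_def)
  then obtain a where "\<forall>r\<in>{1..R}. norm (a r) = 1 \<and> (\<exists>\<alpha>. \<alpha> \<noteq> 0 \<and> Gs r = \<alpha> *\<^sub>R tensor_power (a r))"
    by (rule bchoice[THEN exE])
  then have a: "norm (a r) = 1" and Gs: "\<exists>\<alpha>. \<alpha> \<noteq> 0 \<and> Gs r = \<alpha> *\<^sub>R tensor_power (a r)"
    if "r \<in> {1..R}" for r
    using that by blast+
  let ?T = "\<lambda>r. range (power_deriv (a r) :: _ \<Rightarrow> ('d, 'm) tensor)"
  let ?D = "sqrt (real CARD('d))"
  have T: "tangent_space veronese (Gs r) = ?T r" if "r \<in> {1..R}" for r
    using Gs[OF that] a[OF that] by (auto simp: tangent_space_veronese)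
  have TQ: "tangent_space veronese (tensor_map Q (Gs r)) = range (power_deriv (Q *v a r))"
    if "orthonormal_columns Q" "r \<in> {1..R}" for Q :: "real ^ 'm ^ 'n" and r
    using Gs[OF that(2)] a[OF that(2)] that(1) by (auto simp: tangent_space_veronese_tensor_map)
  have TU: "tangent_space veronese (tensor_map U (Gs r)) = range (power_deriv (U *v a r))"
    if "orthonormal_columns U" "r \<in> {1..R}" for U :: "real ^ 'm ^ 'l" and r
    using Gs[OF that(2)] a[OF that(2)] that(1) by (auto simp: tangent_space_veronese_tensor_map)
  show ?thesis
  proof (rule conjI; intro allI impI; elim conjE)
    fix Q :: "real ^ 'm ^ 'n" and As :: "nat \<Rightarrow> ('d, 'n) tensor"
    assume Q: "orthonormal_columns Q" and As: "\<forall>r\<in>{1..R}. As r = tensor_map Q (Gs r)"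
    have V: "tangent_space veronese (As r) = range (power_deriv (Q *v a r))"
      and W: "tangent_space (compressed_veronese Q) (As r) = tensor_map Q ` ?T r"
      if "r \<in> {1..R}" for r
      using As that by (simp_all add: TQ[OF Q] T tangent_space_compressed_veronese[OF Q])
    have subV: "subspace (tangent_space veronese (As r))" if "r \<in> {1..R}" for r
      unfolding V[OF that] by (rule subspace_range_power_deriv)
    have subW: "subspace (tangent_space (compressed_veronese Q) (As r))" if "r \<in> {1..R}" for r
      unfolding W[OF that] by (intro linear_subspace_image linear_tensor_map subspace_range_power_deriv)
    have subG: "subspace (tangent_space veronese (Gs r))" if "r \<in> {1..R}" for r
      unfolding T[OF that] by (rule subspace_range_power_deriv)
    \<comment> \<open>The compressed manifold lies inside the Veronese manifold, so its tangent
      spaces are smaller and every lower bound restricts to them.\<close>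
    have "condition_number (compressed_veronese Q) R As \<le> ennreal 1 * condition_number veronese R As"
    proof (rule condition_number_le[OF subV subW])
      fix c assume "lower_sum_bound c {1..R} (\<lambda>r. tangent_space veronese (As r))"
      then show "lower_sum_bound (c / 1) {1..R} (\<lambda>r. tangent_space (compressed_veronese Q) (As r))"
        unfolding div_by_1
        by (rule lower_sum_bound_subset) (rule tangent_space_subset[OF compressed_veronese_subset[OF Q]])
    qed auto
    then have le: "condition_number (compressed_veronese Q) R As \<le> condition_number veronese R As"
      by simp
    have le_sqrt: "condition_number veronese R As \<le> ennreal ?D * condition_number veronese R Gs"
    proof (rule condition_number_le[OF subG subV])
      fix c :: real assume c: "c \<ge> 0" and "lower_sum_bound c {1..R} (\<lambda>r. tangent_space veronese (Gs r))"
      then have L: "lower_sum_bound c {1..R} ?T"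
        by (simp only: lower_sum_bound_cong[OF T])
      \<comment> \<open>The tangent part admits the constant \<open>c\<close>, the Gram part only
        \<open>c / ?D\<close>. The smaller one serves both, as D is at least 1.\<close>
      have "c / ?D \<le> c / 1"
        using c by (intro divide_left_mono) (auto simp: Suc_le_eq)
      then have "lower_sum_bound (c / ?D) {1..R} ?T"
        using c by (intro lower_sum_bound_mono[OF L]) auto
      then have "lower_sum_bound (c / ?D) {1..R} (\<lambda>r. range (power_deriv (Q *v a r) :: _ \<Rightarrow> ('d, 'n) tensor))"
        using gram_bound_of_lower_sum_bound[OF L] a by (intro lower_sum_bound_embedI[OF Q]) auto
      then show "lower_sum_bound (c / ?D) {1..R} (\<lambda>r. tangent_space veronese (As r))"
        by (simp only: lower_sum_bound_cong[OF V])
    qed auto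
    \<comment> \<open>\<open>tensor_map Q\<close> is a linear isometry that carries the tangent
      spaces at the \<open>Gs r\<close> onto those at the \<open>As r\<close>.\<close>
    have "condition_number veronese R Gs = condition_number (compressed_veronese Q) R As"
      using lower_sum_bound_isometry[OF linear_tensor_map norm_tensor_map[OF Q], of "{1..R}"
          "\<lambda>r. tangent_space (compressed_veronese Q) (As r)" "\<lambda>r. tangent_space veronese (Gs r)"]
      by (intro condition_number_eqI subG subW) (simp_all add: T W)
    with le le_sqrt show "condition_number (compressed_veronese Q) R As \<le> condition_number veronese R As \<and>
        condition_number veronese R As \<le> ennreal ?D * condition_number veronese R Gs \<and>
        ennreal ?D * condition_number veronese R Gs
          = ennreal ?D * condition_number (compressed_veronese Q) R As"
      by simp
  next
    fix Q :: "real ^ 'm ^ 'n" and As :: "nat \<Rightarrow> ('d, 'n) tensor"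
      and U :: "real ^ 'm ^ 'l" and Bs :: "nat \<Rightarrow> ('d, 'l) tensor"
    assume Q: "orthonormal_columns Q" and As: "\<forall>r\<in>{1..R}. As r = tensor_map Q (Gs r)"
      and U: "orthonormal_columns U" and Bs: "\<forall>r\<in>{1..R}. Bs r = tensor_map U (Gs r)"
      and card: "min CARD('l) CARD('n) > CARD('m)"
    have A: "tangent_space veronese (As r) = range (power_deriv (Q *v a r))"
      and B: "tangent_space veronese (Bs r) = range (power_deriv (U *v a r))"
      if "r \<in> {1..R}" for r
      using As Bs that by (simp_all add: TQ[OF Q] TU[OF U])
    show "condition_number veronese R As = condition_number veronese R Bs"
    proof (rule condition_number_eqI)
      fix c
      have "lower_sum_bound c {1..R} (\<lambda>r. tangent_space veronese (As r)) \<longleftrightarrow>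
          lower_sum_bound c {1..R} (\<lambda>r. range (power_deriv (Q *v a r) :: _ \<Rightarrow> ('d, 'n) tensor))"
        by (rule lower_sum_bound_cong) (rule A)
      also have "\<dots> \<longleftrightarrow> lower_sum_bound c {1..R} ?T \<and> gram_bound (CARD('d) - 1) c {1..R} a"
        by (rule lower_sum_bound_embed_iff[OF Q _ a]) (use card in auto)
      also have "\<dots> \<longleftrightarrow>
          lower_sum_bound c {1..R} (\<lambda>r. range (power_deriv (U *v a r) :: _ \<Rightarrow> ('d, 'l) tensor))"
        by (rule lower_sum_bound_embed_iff[OF U _ a, symmetric]) (use card in auto)
      also have "\<dots> \<longleftrightarrow> lower_sum_bound c {1..R} (\<lambda>r. tangent_space veronese (Bs r))"
        by (rule lower_sum_bound_cong) (rule B[symmetric])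
      finally show "lower_sum_bound c {1..R} (\<lambda>r. tangent_space veronese (As r)) \<longleftrightarrow>
          lower_sum_bound c {1..R} (\<lambda>r. tangent_space veronese (Bs r))" .
    qed (simp_all add: A B subspace_range_power_deriv del: One_nat_def)
  qed
qed

end
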